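(* Let $n_\mathcal{G}=3$, $n_\mathcal{H}=2$ and $k_\mathcal{G}=k_\mathcal{H}=1$, and let $(\alpha,\beta,\delta)$ be any of $\big(-\sqrt3,\tfrac49\sqrt3,-\tfrac19\sqrt6\big)$, $\big(-\sqrt3,\tfrac49\sqrt3,\tfrac19\sqrt6\big)$, $\big(\sqrt3,-\tfrac49\sqrt3,-\tfrac19\sqrt6\big)$, $\big(\sqrt3,-\tfrac49\sqrt3,\tfrac19\sqrt6\big)$. Then for every choice of $(g,h)\in V(\mathcal{G}\square\mathcal{H})$ the polynomials $s_{g^*h^*}=x_{g^*h^*}$ for all $(g^*,h^* )\in V(\mathcal{G}\square\mathcal{H})$ with $g^*\ne g$ and $h^*\neq h$, $s_1=-\alpha+\alpha\rho^1_{gh}+\beta\rho^2_{gh}$ and $s_2=\delta\rho^2_{gh}$ form a $2$-SOS-certificate of $f_{\text{viz}}$, i.e. $f_{\text{viz}}\equiv\sum_{g^*\neq g,h^*\ne h}s_{g^*h^*}^2+s_1^2+s_2^2\pmod{I_{\text{viz}}}$; consequently Vizing's conjecture holds for these graph classes.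
   Context: Let $\mathbb{K}\subseteq\mathbb{R}$ be a field containing the numbers used. Let $V(\mathcal{G})=\{g_1,\dots,g_{n_\mathcal{G}}\}$, $V(\mathcal{H})=\{h_1,\dots,h_{n_\mathcal{H}}\}$, $V(\mathcal{G}\square\mathcal{H})=V(\mathcal{G})\times V(\mathcal{H})$; $\mathcal{G}$ ($\mathcal{H}$) is the class of graphs on $V(\mathcal{G})$ ($V(\mathcal{H})$) with minimum dominating set $\{g_1\}$ ($\{h_1\}$). Introduce an edge variable $e_{gg'}=e_{g'g}$ for every unordered pair of distinct $g,g'\in V(\mathcal{G})$, an edge variable $e_{hh'}=e_{h'h}$ for every unordered pair of distinct $h,h'\in V(\mathcal{H})$, and a vertex variable $x_{gh}$ for every $(g,h)\in V(\mathcal{G}\square\mathcal{H})$; let $P$ be the polynomial ring over $\mathbb{K}$ in all these variables. For $k_\mathcal{G}=k_\mathcal{H}=1$ the Vizing ideal $I_{\text{viz}}\subseteq P$ is generated by: $e_{gg'}(e_{gg'}-1)$ for all distinct $g,g'\in V(\mathcal{G})$; $1-e_{gg_1}$ for all $g\ne g_1$; $e_{hh'}(e_{hh'}-1)$ for all distinct $h,h'\in V(\mathcal{H})$; $1-e_{hh_1}$ for all $h\neq h_1$; and, for all $(g,h)$, $x_{gh}(x_{gh}-1)$ and $(1-x_{gh})\prod_{g'\ne g}(1-e_{gg'}x_{g'h})\prod_{h'\neq h}(1-e_{hh'}x_{gh'})$. The Vizing polynomial is $f_{\text{viz}}=\big(\sum_{(g,h)}x_{gh}\big)-k_\mathcal{G}k_\mathcal{H}$.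 A polynomial $f$ is $\ell$-SOS modulo $I$ if $f-\sum_i s_i^2\in I$ for some polynomials $s_i$ of degree at most $\ell$ (an SOS-certificate of degree $\ell$); by prior work, $f_{\text{viz}}$ being $\ell$-SOS modulo $I_{\text{viz}}$ implies $\gamma(G\square H)\ge\gamma(G)\gamma(H)$ for all $G\in\mathcal{G}$, $H\in\mathcal{H}$ ($\gamma$ = domination number, $\square$ = Cartesian product). For $(g,h)$ let $T_{gh}=\{(g',h') : g'=g\text{ or }h'=h\}$ and $\rho^i_{gh}=\sum_{S\subseteq T_{gh},\,|S|=i}\prod_{(g',h')\in S}x_{g'h'}$. *)

theory Defs
  imports
    Complex_Main
    "HOL-Library.Poly_Mapping"
    "HOL-Library.Multiset"
    "HOL-Algebra.Algebraic_Closure_Type"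
    "Graph_Theory.Pair_Digraph"
begin

section \<open>Multivariate polynomials with coefficients in a subfield of the reals\<close>

type_synonym 'v real_mpoly = "('v \<Rightarrow>\<^sub>0 nat) \<Rightarrow>\<^sub>0 real"

definition Var\<^sub>p :: "'v \<Rightarrow> 'v real_mpoly" where
  "Var\<^sub>p v = Poly_Mapping.single (Poly_Mapping.single v 1) 1"

definition Const\<^sub>p :: "real \<Rightarrow> 'v real_mpoly" where
  "Const\<^sub>p c = Poly_Mapping.single 0 c"

definition total_degree :: "'v real_mpoly \<Rightarrow> nat" where
  "total_degree p =
     Max (insert 0 ((\<lambda>m. \<Sum>v\<in>Poly_Mapping.keys m. Poly_Mapping.lookup m v) ` Poly_Mapping.keys p))"

definition mpoly_ring :: "real set \<Rightarrow> 'v set \<Rightarrow> 'v real_mpoly ring" where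
  "mpoly_ring K Vs = ring_of_type_algebra
     \<lparr>carrier := {p. \<forall>m\<in>Poly_Mapping.keys p. Poly_Mapping.keys m \<subseteq> Vs \<and> Poly_Mapping.lookup p m \<in> K}\<rparr>"

text \<open>
  A certificate is a finite multiset of summands: the same polynomial may be squared several times.
\<close>
definition sos_certificate ::
  "'v real_mpoly ring \<Rightarrow> 'v real_mpoly set \<Rightarrow> nat \<Rightarrow> 'v real_mpoly \<Rightarrow> 'v real_mpoly multiset \<Rightarrow> bool"
where
  "sos_certificate P I l f ss \<longleftrightarrow>
     (\<forall>s\<in>#ss. s \<in> carrier P \<and> total_degree s \<le> l) \<and> f - (\<Sum>s\<in>#ss. s\<^sup>2) \<in> I"

section \<open>The Vizing ideal and the Vizing polynomial\<close>

text \<open>Edge variables are indexed by unordered pairs, i.e. by two-element sets.\<close>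
datatype ('g, 'h) viz_var = EdgeG "'g set" | EdgeH "'h set" | Vert 'g 'h

definition viz_vars :: "'g set \<Rightarrow> 'h set \<Rightarrow> ('g, 'h) viz_var set" where
  "viz_vars VG VH =
     {EdgeG {g, g'} | g g'. g \<in> VG \<and> g' \<in> VG \<and> g \<noteq> g'} \<union>
     {EdgeH {h, h'} | h h'. h \<in> VH \<and> h' \<in> VH \<and> h \<noteq> h'} \<union>
     {Vert g h | g h. g \<in> VG \<and> h \<in> VH}"

definition viz_ring :: "real set \<Rightarrow> 'g set \<Rightarrow> 'h set \<Rightarrow> ('g, 'h) viz_var real_mpoly ring" where
  "viz_ring K VG VH = mpoly_ring K (viz_vars VG VH)"

definition eG :: "'g \<Rightarrow> 'g \<Rightarrow> ('g, 'h) viz_var real_mpoly" where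
  "eG g g' = Var\<^sub>p (EdgeG {g, g'})"

definition eH :: "'h \<Rightarrow> 'h \<Rightarrow> ('g, 'h) viz_var real_mpoly" where
  "eH h h' = Var\<^sub>p (EdgeH {h, h'})"

definition xv :: "'g \<Rightarrow> 'h \<Rightarrow> ('g, 'h) viz_var real_mpoly" where
  "xv g h = Var\<^sub>p (Vert g h)"

text \<open>The case of one-element minimum dominating sets \<open>{g1}\<close> and \<open>{h1}\<close>.\<close>
definition viz_generators ::
  "'g set \<Rightarrow> 'g \<Rightarrow> 'h set \<Rightarrow> 'h \<Rightarrow> ('g, 'h) viz_var real_mpoly set"
where
  "viz_generators VG g1 VH h1 =
     {eG g g' * (eG g g' - 1) | g g'. g \<in> VG \<and> g' \<in> VG \<and> g \<noteq> g'} \<union>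
     {1 - eG g g1 | g. g \<in> VG \<and> g \<noteq> g1} \<union>
     {eH h h' * (eH h h' - 1) | h h'. h \<in> VH \<and> h' \<in> VH \<and> h \<noteq> h'} \<union>
     {1 - eH h h1 | h. h \<in> VH \<and> h \<noteq> h1} \<union>
     {xv g h * (xv g h - 1) | g h. g \<in> VG \<and> h \<in> VH} \<union>
     {(1 - xv g h) * (\<Prod>g'\<in>VG - {g}. 1 - eG g g' * xv g' h)
                   * (\<Prod>h'\<in>VH - {h}. 1 - eH h h' * xv g h') | g h. g \<in> VG \<and> h \<in> VH}"

definition viz_ideal ::
  "real set \<Rightarrow> 'g set \<Rightarrow> 'g \<Rightarrow> 'h set \<Rightarrow> 'h \<Rightarrow> ('g, 'h) viz_var real_mpoly set"
where
  "viz_ideal K VG g1 VH h1 = Idl\<^bsub>viz_ring K VG VH\<^esub> (viz_generators VG g1 VH h1)"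

definition viz_poly :: "'g set \<Rightarrow> 'h set \<Rightarrow> nat \<Rightarrow> nat \<Rightarrow> ('g, 'h) viz_var real_mpoly" where
  "viz_poly VG VH kG kH = (\<Sum>(g, h)\<in>VG \<times> VH. xv g h) - of_nat (kG * kH)"

definition cross_set :: "'g set \<Rightarrow> 'h set \<Rightarrow> 'g \<Rightarrow> 'h \<Rightarrow> ('g \<times> 'h) set" where
  "cross_set VG VH g h = {(g', h') \<in> VG \<times> VH. g' = g \<or> h' = h}"

definition rho ::
  "'g set \<Rightarrow> 'h set \<Rightarrow> 'g \<Rightarrow> 'h \<Rightarrow> nat \<Rightarrow> ('g, 'h) viz_var real_mpoly"
where
  "rho VG VH g h i =
     (\<Sum>S | S \<subseteq> cross_set VG VH g h \<and> card S = i. \<Prod>(g', h')\<in>S. xv g' h')"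

section \<open>Domination in finite simple graphs\<close>

text \<open>
  A finite simple graph is a \<open>pair_graph\<close>: finite, loop-free, with a symmetric arc relation.
\<close>
definition dominating_set :: "'a pair_pre_digraph \<Rightarrow> 'a set \<Rightarrow> bool" where
  "dominating_set G D \<longleftrightarrow>
     D \<subseteq> pverts G \<and> (\<forall>v\<in>pverts G - D. \<exists>u\<in>D. (u, v) \<in> parcs G)"

definition domination_number :: "'a pair_pre_digraph \<Rightarrow> nat" where
  "domination_number G = Min (card ` {D. dominating_set G D})"

definition min_dominating_set :: "'a pair_pre_digraph \<Rightarrow> 'a set \<Rightarrow> bool" where
  "min_dominating_set G D \<longleftrightarrow> dominating_set G D \<and> card D = domination_number G"

definition graph_class :: "'a set \<Rightarrow> 'a set \<Rightarrow> 'a pair_pre_digraph set" where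
  "graph_class V D = {G. pair_graph G \<and> pverts G = V \<and> min_dominating_set G D}"

definition cart_prod ::
  "'a pair_pre_digraph \<Rightarrow> 'b pair_pre_digraph \<Rightarrow> ('a \<times> 'b) pair_pre_digraph" (infixl \<open>\<box>\<close> 70)
where
  "G \<box> H = \<lparr>pverts = pverts G \<times> pverts H,
            parcs = {((g, h), (g', h')). g \<in> pverts G \<and> g' \<in> pverts G \<and> h \<in> pverts H \<and> h' \<in> pverts H \<and>
                       (g = g' \<and> (h, h') \<in> parcs H \<or> h = h' \<and> (g, g') \<in> parcs G)}\<rparr>"

section \<open>Well-formedness of the polynomial ring\<close>

text \<open>
  \<open>genideal\<close> is an intersection over all ideals containing the given set, so it is only meaningful
  in a ring whose carrier contains that set; the following facts establish this.
\<close>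

abbreviation real_ring :: "real ring" where
  "real_ring \<equiv> ring_of_type_algebra"

lemma subfield_real_closed:
  assumes "subfield K real_ring"
  shows "0 \<in> K" "1 \<in> K" "\<And>a. a \<in> K \<Longrightarrow> - a \<in> K"
    "\<And>a b. a \<in> K \<Longrightarrow> b \<in> K \<Longrightarrow> a + b \<in> K" "\<And>a b. a \<in> K \<Longrightarrow> b \<in> K \<Longrightarrow> a * b \<in> K"
proof -
  have R: "ring real_ring" by (rule ring_from_type_algebra)
  have s: "subring K real_ring"
    using assms by (meson subfield.axioms(1) subdomain.axioms(1) subcring.axioms(1))
  have neg: "\<ominus>\<^bsub>real_ring\<^esub> a = - a" for a
  proof (rule abelian_group.minus_equality)
    show "abelian_group real_ring" using R by (simp add: ring_def)
  qed (auto simp: ring_of_type_algebra_def)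
  show "0 \<in> K" using subringE(2)[OF s] by (simp add: ring_of_type_algebra_def)
  show "1 \<in> K" using subringE(3)[OF s] by (simp add: ring_of_type_algebra_def)
  show "- a \<in> K" if "a \<in> K" for a using subringE(5)[OF s that] by (simp add: neg)
  show "a + b \<in> K" if "a \<in> K" "b \<in> K" for a b
    using subringE(7)[OF s that] by (simp add: ring_of_type_algebra_def)
  show "a * b \<in> K" if "a \<in> K" "b \<in> K" for a b
    using subringE(6)[OF s that] by (simp add: ring_of_type_algebra_def)
qed

lemma mpoly_ring_carrier_iff:
  assumes "0 \<in> K"
  shows "p \<in> carrier (mpoly_ring K Vs) \<longleftrightarrow>
    (\<forall>m. Poly_Mapping.lookup p m \<in> K) \<and> (\<forall>m\<in>Poly_Mapping.keys p. Poly_Mapping.keys m \<subseteq> Vs)"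
proof -
  have "Poly_Mapping.lookup p m \<in> K" if "m \<notin> Poly_Mapping.keys p" for m
    using assms that by (simp add: in_keys_iff)
  then show ?thesis
    by (auto simp: mpoly_ring_def)
qed

lemma mpoly_ring_subring:
  assumes K: "subfield K real_ring"
  shows "subring (carrier (mpoly_ring K Vs)) (ring_of_type_algebra :: 'v real_mpoly ring)"
proof -
  note cl = subfield_real_closed[OF K]
  note iff = mpoly_ring_carrier_iff[OF cl(1)]
  let ?R = "ring_of_type_algebra :: 'v real_mpoly ring"
  have R: "ring ?R" by (rule ring_from_type_algebra)
  have neg: "\<ominus>\<^bsub>?R\<^esub> a = - a" for a
  proof (rule abelian_group.minus_equality)
    show "abelian_group ?R" using R by (simp add: ring_def)
  qed (auto simp: ring_of_type_algebra_def)
  have sumK: "sum f A \<in> K" if "\<And>i. i \<in> A \<Longrightarrow> f i \<in> K" for A :: "'b set" and f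
    using that by (induction A rule: infinite_finite_induct) (auto simp: cl)
  have prod: "p * q \<in> carrier (mpoly_ring K Vs)"
    if p: "p \<in> carrier (mpoly_ring K Vs)" and q: "q \<in> carrier (mpoly_ring K Vs)" for p q :: "'v real_mpoly"
  proof -
    have "Poly_Mapping.lookup (p * q) m \<in> K" for m
      using p q unfolding lookup_mult Sum_any.expand_set iff
      by (intro sumK cl(5)) (auto simp: when_def cl Sum_any.expand_set intro!: sumK)
    moreover have "Poly_Mapping.keys m \<subseteq> Vs" if m: "m \<in> Poly_Mapping.keys (p * q)" for m
    proof -
      obtain a b where "m = a + b" "a \<in> Poly_Mapping.keys p" "b \<in> Poly_Mapping.keys q"
        using keys_mult[of p q] m by blast
      then show ?thesis
        using p q Poly_Mapping.keys_add[of a b] unfolding iff by blast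
    qed
    ultimately show ?thesis unfolding iff by blast
  qed
  show ?thesis
  proof (rule ring.subringI[OF R])
    show "carrier (mpoly_ring K Vs) \<subseteq> carrier ?R"
      by (simp add: ring_of_type_algebra_def)
    show "\<one>\<^bsub>?R\<^esub> \<in> carrier (mpoly_ring K Vs)"
      by (auto simp: iff ring_of_type_algebra_def lookup_one when_def cl)
    show "\<ominus>\<^bsub>?R\<^esub> p \<in> carrier (mpoly_ring K Vs)" if "p \<in> carrier (mpoly_ring K Vs)" for p
      using that by (auto simp: neg iff cl)
    show "p \<otimes>\<^bsub>?R\<^esub> q \<in> carrier (mpoly_ring K Vs)"
      if "p \<in> carrier (mpoly_ring K Vs)" "q \<in> carrier (mpoly_ring K Vs)" for p q
      using prod[OF that] by (simp add: ring_of_type_algebra_def)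
    show "p \<oplus>\<^bsub>?R\<^esub> q \<in> carrier (mpoly_ring K Vs)"
      if "p \<in> carrier (mpoly_ring K Vs)" "q \<in> carrier (mpoly_ring K Vs)" for p q
    proof -
      have "p + q \<in> carrier (mpoly_ring K Vs)"
        using that Poly_Mapping.keys_add[of p q] unfolding iff lookup_add
        by (blast intro: cl)
      then show ?thesis by (simp add: ring_of_type_algebra_def)
    qed
  qed
qed

lemma mpoly_ring_cring:
  assumes "subfield K real_ring"
  shows "cring (mpoly_ring K Vs :: 'v real_mpoly ring)"
proof -
  let ?R = "ring_of_type_algebra :: 'v real_mpoly ring"
  let ?C = "carrier (mpoly_ring K Vs :: 'v real_mpoly ring)"
  have "subcring ?C ?R"
    by (rule cring.subcringI'[OF cring_from_type_algebra mpoly_ring_subring[OF assms]])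
  moreover have "?C \<subseteq> carrier ?R"
    by (simp add: ring_of_type_algebra_def)
  ultimately have "cring (?R \<lparr>carrier := ?C\<rparr>)"
    using ring.subcring_iff[OF ring_from_type_algebra] by blast
  then show ?thesis by (simp add: mpoly_ring_def)
qed

lemma viz_generators_carrier:
  assumes K: "subfield K real_ring"
    and "g1 \<in> VG" "h1 \<in> VH"
  shows "viz_generators VG g1 VH h1 \<subseteq> carrier (viz_ring K VG VH)"
proof -
  note cl = subfield_real_closed[OF K]
  note iff = mpoly_ring_carrier_iff[OF cl(1)]
  let ?C = "carrier (viz_ring K VG VH)"
  interpret P: cring "viz_ring K VG VH"
    unfolding viz_ring_def by (rule mpoly_ring_cring[OF K])
  have mult: "p * q \<in> ?C" if "p \<in> ?C" "q \<in> ?C" for p q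
    using P.m_closed[OF that] by (simp add: viz_ring_def mpoly_ring_def ring_of_type_algebra_def)
  have one: "1 \<in> ?C"
    using P.one_closed by (simp add: viz_ring_def mpoly_ring_def ring_of_type_algebra_def)
  have diff: "p - q \<in> ?C" if "p \<in> ?C" "q \<in> ?C" for p q
  proof -
    have "- q \<in> ?C" using that(2) unfolding viz_ring_def iff by (auto simp: cl)
    from P.a_closed[OF that(1) this] show ?thesis
      by (simp add: viz_ring_def mpoly_ring_def ring_of_type_algebra_def)
  qed
  have prod: "prod f A \<in> ?C" if "\<And>i. i \<in> A \<Longrightarrow> f i \<in> ?C" for f and A :: "'c set"
    using that by (induction A rule: infinite_finite_induct) (auto simp: one mult)
  have Var: "Var\<^sub>p v \<in> ?C" if "v \<in> viz_vars VG VH" for v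
    using that unfolding viz_ring_def iff
    by (auto simp: Var\<^sub>p_def lookup_single when_def cl)
  have x: "xv g h \<in> ?C" if "g \<in> VG" "h \<in> VH" for g h
    unfolding xv_def using that by (intro Var) (auto simp: viz_vars_def)
  have eG: "eG g g' \<in> ?C" if "g \<in> VG" "g' \<in> VG" "g \<noteq> g'" for g g'
    unfolding eG_def using that by (intro Var) (auto simp: viz_vars_def)
  have eH: "eH h h' \<in> ?C" if "h \<in> VH" "h' \<in> VH" "h \<noteq> h'" for h h'
    unfolding eH_def using that by (intro Var) (auto simp: viz_vars_def)
  show ?thesis
    unfolding viz_generators_def using assms(2,3)
    by (auto intro!: mult diff prod one x eG eH)
qed

end

theory Submission
  imports Defs
begin

text \<open>
  Let \<open>x\<^sub>1, \<dots>, x\<^sub>4\<close> be the variables of the cross \<open>T\<^sub>g\<^sub>h\<close>. Since \<open>(1 - e x) (1 - x) \<equiv> 1 - x\<close> whenever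
  \<open>x\<^sup>2 \<equiv> x\<close>, the domination generator at \<open>(g, h)\<close> puts \<open>\<Prod>(1 - x\<^sub>i)\<close> into the ideal. On points
  with \<open>t\<close> of the \<open>x\<^sub>i\<close> equal to 1, \<open>t - 1 - s\<^sub>1\<^sup>2 - s\<^sub>2\<^sup>2\<close> vanishes for \<open>t = 1, 2, 3, 4\<close> and is \<open>-4\<close> for
  \<open>t = 0\<close>; hence it is congruent to \<open>-4 \<Prod>(1 - x\<^sub>i)\<close> modulo the idempotency relations. The variables
  outside the cross are their own squares modulo the ideal.
\<close>

section \<open>Ideals of subrings in type-class notation\<close>

text \<open>Polynomial identities are then proved in the whole type by \<open>algebra_simps\<close>;
  only membership in \<open>C\<close> and \<open>I\<close> remains to be tracked.\<close>

locale subring_ideal =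
  fixes C I :: "'a::comm_ring_1 set"
  assumes one: "1 \<in> C"
    and add: "p \<in> C \<Longrightarrow> q \<in> C \<Longrightarrow> p + q \<in> C"
    and uminus: "p \<in> C \<Longrightarrow> - p \<in> C"
    and mult: "p \<in> C \<Longrightarrow> q \<in> C \<Longrightarrow> p * q \<in> C"
    and ideal_subset: "I \<subseteq> C"
    and ideal_zero: "0 \<in> I"
    and ideal_add: "p \<in> I \<Longrightarrow> q \<in> I \<Longrightarrow> p + q \<in> I"
    and ideal_mult: "p \<in> C \<Longrightarrow> q \<in> I \<Longrightarrow> p * q \<in> I"
begin

lemma zero: "0 \<in> C"
  using ideal_subset ideal_zero by blast

lemma diff: "p \<in> C \<Longrightarrow> q \<in> C \<Longrightarrow> p - q \<in> C"
  using add[OF _ uminus] by simp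

lemma of_nat: "of_nat n \<in> C"
  by (induction n) (auto intro: zero one add)

lemma numeral: "numeral n \<in> C"
  using of_nat[of "numeral n"] by simp

lemma sum: "(\<And>i. i \<in> A \<Longrightarrow> f i \<in> C) \<Longrightarrow> sum f A \<in> C"
  by (induction A rule: infinite_finite_induct) (auto intro: zero add)

lemma prod: "(\<And>i. i \<in> A \<Longrightarrow> f i \<in> C) \<Longrightarrow> prod f A \<in> C"
  by (induction A rule: infinite_finite_induct) (auto intro: one mult)

lemma ideal_uminus: "p \<in> I \<Longrightarrow> - p \<in> I"
  using ideal_mult[OF uminus[OF one]] by simp

lemma ideal_diff: "p \<in> I \<Longrightarrow> q \<in> I \<Longrightarrow> p - q \<in> I"
  using ideal_add[OF _ ideal_uminus] by simp

lemma ideal_sum: "(\<And>i. i \<in> A \<Longrightarrow> f i \<in> I) \<Longrightarrow> sum f A \<in> I"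
  by (induction A rule: infinite_finite_induct) (auto intro: ideal_zero ideal_add)

lemmas carrier_intros = one add uminus mult zero diff numeral

text \<open>Multiplying by \<open>1 - x\<close> erases the edge variable: (1 - x)(1 - e x) = (1 - x)
  + e x(x - 1). The prefix \<open>q\<close> carries the other factors of a product, so that edge
  variables can be removed one at a time.\<close>

lemma absorb_idempotent:
  assumes "q \<in> C" "e \<in> C" "x \<in> C" "x * (x - 1) \<in> I" "q * (1 - e * x) \<in> I"
  shows "q * (1 - x) \<in> I"
proof -
  have "q * (1 - x) = (1 - x) * (q * (1 - e * x)) - (q * e) * (x * (x - 1))"
    by (simp add: algebra_simps)
  also have "\<dots> \<in> I"
    by (intro ideal_diff ideal_mult carrier_intros assms)
  finally show ?thesis .
qed

text \<open>
  The hypotheses on \<open>\<alpha>, \<beta>, \<delta>\<close> match the coefficients of the elementary symmetric polynomials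
  after reducing modulo idempotency via \<open>(e\<^sub>1 - 1)\<^sup>2 \<equiv> 1 - e\<^sub>1 + 2 e\<^sub>2\<close>,
  \<open>(e\<^sub>1 - 1) e\<^sub>2 \<equiv> e\<^sub>2 + 3 e\<^sub>3\<close> and \<open>e\<^sub>2\<^sup>2 \<equiv> e\<^sub>2 + 6 e\<^sub>3 + 6 e\<^sub>4\<close>. They are stated without
  fractions because the ring need not contain \<open>1/3\<close>.
\<close>
lemma four_idempotents_sos:
  fixes a b c d \<alpha> \<beta> \<delta> :: 'a
  defines "\<rho>\<^sub>1 \<equiv> a + b + c + d"
    and "\<rho>\<^sub>2 \<equiv> a * b + a * c + a * d + b * c + b * d + c * d"
  assumes C: "a \<in> C" "b \<in> C" "c \<in> C" "d \<in> C" "\<alpha> \<in> C" "\<beta> \<in> C" "\<delta> \<in> C"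
    and idem: "a * (a - 1) \<in> I" "b * (b - 1) \<in> I" "c * (c - 1) \<in> I" "d * (d - 1) \<in> I"
    and cover: "(1 - a) * (1 - b) * (1 - c) * (1 - d) \<in> I"
    and coeffs: "\<alpha>\<^sup>2 = 3" "2 * (\<alpha> * \<beta>) + (\<beta>\<^sup>2 + \<delta>\<^sup>2) = -2"
      "6 * (\<alpha> * \<beta>) = -8" "6 * (\<beta>\<^sup>2 + \<delta>\<^sup>2) = 4"
  shows "\<rho>\<^sub>1 - 1 - ((- \<alpha> + \<alpha> * \<rho>\<^sub>1 + \<beta> * \<rho>\<^sub>2)\<^sup>2 + (\<delta> * \<rho>\<^sub>2)\<^sup>2) \<in> I"
proof -
  define \<rho>\<^sub>3 \<rho>\<^sub>4 where "\<rho>\<^sub>3 = a * b * c + a * b * d + a * c * d + b * c * d"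
    and "\<rho>\<^sub>4 = a * b * c * d"
  \<comment> \<open>The exact error terms of the three congruences. In \<open>i\<^sub>3\<close> a
    term a^2 b^2 is reduced first in \<open>a\<close>, with cofactor b^2, and then in
    \<open>b\<close>, with cofactor \<open>a\<close>; hence the asymmetry of its rows.\<close>
  define i\<^sub>1 i\<^sub>2 i\<^sub>3 where
    "i\<^sub>1 = a * (a - 1) + b * (b - 1) + c * (c - 1) + d * (d - 1)" and
    "i\<^sub>2 = (b + c + d) * (a * (a - 1)) + (a + c + d) * (b * (b - 1))
         + (a + b + d) * (c * (c - 1)) + (a + b + c) * (d * (d - 1))" and
    "i\<^sub>3 = (b * b + c * c + d * d + 2 * (b * c + b * d + c * d)) * (a * (a - 1))
         + (a + c * c + d * d + 2 * (a * c + a * d + c * d)) * (b * (b - 1))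
         + (a + b + d * d + 2 * (a * b + a * d + b * d)) * (c * (c - 1))
         + (a + b + c + 2 * (a * b + a * c + b * c)) * (d * (d - 1))"
  have i: "i\<^sub>1 \<in> I" "i\<^sub>2 \<in> I" "i\<^sub>3 \<in> I"
    unfolding i\<^sub>1_def i\<^sub>2_def i\<^sub>3_def
    by (intro ideal_add ideal_mult idem carrier_intros C)+
  have e1: "(\<rho>\<^sub>1 - 1)\<^sup>2 = i\<^sub>1 + 1 - \<rho>\<^sub>1 + 2 * \<rho>\<^sub>2"
    unfolding \<rho>\<^sub>1_def \<rho>\<^sub>2_def i\<^sub>1_def by (simp add: algebra_simps power2_eq_square)
  have e2: "(\<rho>\<^sub>1 - 1) * \<rho>\<^sub>2 = i\<^sub>2 + \<rho>\<^sub>2 + 3 * \<rho>\<^sub>3"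
    unfolding \<rho>\<^sub>1_def \<rho>\<^sub>2_def \<rho>\<^sub>3_def i\<^sub>2_def by (simp add: algebra_simps power2_eq_square)
  have e3: "\<rho>\<^sub>2\<^sup>2 = i\<^sub>3 + \<rho>\<^sub>2 + 6 * \<rho>\<^sub>3 + 6 * \<rho>\<^sub>4"
    unfolding \<rho>\<^sub>2_def \<rho>\<^sub>3_def \<rho>\<^sub>4_def i\<^sub>3_def by (simp add: algebra_simps power2_eq_square)
  have e4: "(1 - a) * (1 - b) * (1 - c) * (1 - d) = 1 - \<rho>\<^sub>1 + \<rho>\<^sub>2 - \<rho>\<^sub>3 + \<rho>\<^sub>4"
    unfolding \<rho>\<^sub>1_def \<rho>\<^sub>2_def \<rho>\<^sub>3_def \<rho>\<^sub>4_def by (simp add: algebra_simps power2_eq_square)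
  have "(- \<alpha> + \<alpha> * \<rho>\<^sub>1 + \<beta> * \<rho>\<^sub>2)\<^sup>2 + (\<delta> * \<rho>\<^sub>2)\<^sup>2
      = \<alpha>\<^sup>2 * (\<rho>\<^sub>1 - 1)\<^sup>2 + 2 * (\<alpha> * \<beta>) * ((\<rho>\<^sub>1 - 1) * \<rho>\<^sub>2) + (\<beta>\<^sup>2 + \<delta>\<^sup>2) * \<rho>\<^sub>2\<^sup>2"
    by (simp add: algebra_simps power2_eq_square)
  also have "\<dots> = 3 * i\<^sub>1 + 2 * (\<alpha> * \<beta>) * i\<^sub>2 + (\<beta>\<^sup>2 + \<delta>\<^sup>2) * i\<^sub>3 + 3 - 3 * \<rho>\<^sub>1
      + (6 + (2 * (\<alpha> * \<beta>) + (\<beta>\<^sup>2 + \<delta>\<^sup>2))) * \<rho>\<^sub>2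
      + (6 * (\<alpha> * \<beta>) + 6 * (\<beta>\<^sup>2 + \<delta>\<^sup>2)) * \<rho>\<^sub>3 + 6 * (\<beta>\<^sup>2 + \<delta>\<^sup>2) * \<rho>\<^sub>4"
    unfolding e1 e2 e3 coeffs(1) by (simp add: algebra_simps power2_eq_square)
  \<comment> \<open>The coefficients 4, -4, 4 are four times those in \<open>e4\<close>; subtracting
    \<open>\<rho>\<^sub>1 - 1\<close> turns \<open>3 - 3 * \<rho>\<^sub>1\<close> into
    \<open>4 - 4 * \<rho>\<^sub>1\<close> and completes the product.\<close>
  also have "\<dots> = 3 * i\<^sub>1 + 2 * (\<alpha> * \<beta>) * i\<^sub>2 + (\<beta>\<^sup>2 + \<delta>\<^sup>2) * i\<^sub>3 + 3 - 3 * \<rho>\<^sub>1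
      + 4 * \<rho>\<^sub>2 - 4 * \<rho>\<^sub>3 + 4 * \<rho>\<^sub>4"
    unfolding coeffs(2-4) by simp
  \<comment> \<open>Squares are written as products on the right because
    \<open>carrier_intros\<close> has no rule for powers.\<close>
  finally have "\<rho>\<^sub>1 - 1 - ((- \<alpha> + \<alpha> * \<rho>\<^sub>1 + \<beta> * \<rho>\<^sub>2)\<^sup>2 + (\<delta> * \<rho>\<^sub>2)\<^sup>2)
      = - (3 * i\<^sub>1 + 2 * (\<alpha> * \<beta>) * i\<^sub>2 + (\<beta> * \<beta> + \<delta> * \<delta>) * i\<^sub>3
          + 4 * ((1 - a) * (1 - b) * (1 - c) * (1 - d)))"
    unfolding e4 by (simp add: algebra_simps power2_eq_square)
  also have "\<dots> \<in> I"
    by (intro ideal_uminus ideal_add ideal_mult carrier_intros C i cover)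
  finally show ?thesis .
qed

end

section \<open>Generated ideals of polynomial rings over a subfield\<close>

lemma mpoly_ring_simps:
  "x \<oplus>\<^bsub>mpoly_ring K Vs\<^esub> y = x + y"
  "x \<otimes>\<^bsub>mpoly_ring K Vs\<^esub> y = x * y"
  "\<one>\<^bsub>mpoly_ring K Vs\<^esub> = 1"
  "\<zero>\<^bsub>mpoly_ring K Vs\<^esub> = 0"
  by (simp_all add: mpoly_ring_def ring_of_type_algebra_def)

text \<open>Negation is not a field of the ring record, so closure is read off the
  coefficients.\<close>

lemma uminus_mpoly_ring_closed:
  assumes "subfield K real_ring" "p \<in> carrier (mpoly_ring K Vs)"
  shows "- p \<in> carrier (mpoly_ring K Vs)"
  using assms(2) subfield_real_closed[OF assms(1)]
  by (auto simp: mpoly_ring_carrier_iff)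

lemma subring_ideal_genideal:
  assumes K: "subfield K real_ring" and S: "S \<subseteq> carrier (mpoly_ring K Vs)"
  shows "subring_ideal (carrier (mpoly_ring K Vs)) (Idl\<^bsub>mpoly_ring K Vs\<^esub> S)"
proof -
  interpret P: cring "mpoly_ring K Vs"
    by (rule mpoly_ring_cring[OF K])
  interpret J: ideal "Idl\<^bsub>mpoly_ring K Vs\<^esub> S" "mpoly_ring K Vs"
    by (rule P.genideal_ideal[OF S])
  show ?thesis
  proof
    show "1 \<in> carrier (mpoly_ring K Vs)"
      using P.one_closed unfolding mpoly_ring_simps .
    show "p + q \<in> carrier (mpoly_ring K Vs)"
      if "p \<in> carrier (mpoly_ring K Vs)" "q \<in> carrier (mpoly_ring K Vs)" for p q
      using P.a_closed[OF that] unfolding mpoly_ring_simps .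
    show "- p \<in> carrier (mpoly_ring K Vs)" if "p \<in> carrier (mpoly_ring K Vs)" for p
      using uminus_mpoly_ring_closed[OF K that] .
    show "p * q \<in> carrier (mpoly_ring K Vs)"
      if "p \<in> carrier (mpoly_ring K Vs)" "q \<in> carrier (mpoly_ring K Vs)" for p q
      using P.m_closed[OF that] unfolding mpoly_ring_simps .
    show "Idl\<^bsub>mpoly_ring K Vs\<^esub> S \<subseteq> carrier (mpoly_ring K Vs)"
      by (rule J.a_subset)
    show "0 \<in> Idl\<^bsub>mpoly_ring K Vs\<^esub> S"
      using J.zero_closed unfolding mpoly_ring_simps .
    show "p + q \<in> Idl\<^bsub>mpoly_ring K Vs\<^esub> S"
      if "p \<in> Idl\<^bsub>mpoly_ring K Vs\<^esub> S" "q \<in> Idl\<^bsub>mpoly_ring K Vs\<^esub> S" for p q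
      using J.a_closed[OF that] unfolding mpoly_ring_simps .
    show "p * q \<in> Idl\<^bsub>mpoly_ring K Vs\<^esub> S"
      if "p \<in> carrier (mpoly_ring K Vs)" "q \<in> Idl\<^bsub>mpoly_ring K Vs\<^esub> S" for p q
      using J.I_l_closed[OF that(2,1)] unfolding mpoly_ring_simps .
  qed
qed

lemma generator_in_viz_ideal:
  assumes "subfield K real_ring" "g1 \<in> VG" "h1 \<in> VH" "p \<in> viz_generators VG g1 VH h1"
  shows "p \<in> viz_ideal K VG g1 VH h1"
proof -
  interpret P: cring "viz_ring K VG VH"
    unfolding viz_ring_def by (rule mpoly_ring_cring[OF assms(1)])
  show ?thesis
    unfolding viz_ideal_def
    using P.genideal_self[OF viz_generators_carrier[OF assms(1-3)]] assms(4) by blast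
qed

section \<open>Constants, variables and total degree\<close>

lemma Const\<^sub>p_mult: "Const\<^sub>p a * Const\<^sub>p b = Const\<^sub>p (a * b)"
  by (simp add: Const\<^sub>p_def mult_single)

lemma Const\<^sub>p_add: "Const\<^sub>p a + Const\<^sub>p b = Const\<^sub>p (a + b)"
  by (simp add: Const\<^sub>p_def single_add)

lemma Const\<^sub>p_uminus: "- Const\<^sub>p a = Const\<^sub>p (- a)"
  by (simp add: Const\<^sub>p_def single_uminus)

lemma Const\<^sub>p_numeral: "numeral n = Const\<^sub>p (numeral n)"
  by (simp add: Const\<^sub>p_def single_numeral)

lemma Const\<^sub>p_carrier: "c \<in> K \<Longrightarrow> Const\<^sub>p c \<in> carrier (mpoly_ring K Vs)"
  by (auto simp: Const\<^sub>p_def mpoly_ring_def)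

lemma xv_carrier:
  assumes "subfield K real_ring" "g \<in> VG" "h \<in> VH"
  shows "xv g h \<in> carrier (viz_ring K VG VH)"
  using assms subfield_real_closed[OF assms(1)]
  by (auto simp: xv_def Var\<^sub>p_def viz_ring_def viz_vars_def mpoly_ring_def)

lemma total_degree_le_iff:
  "total_degree p \<le> n \<longleftrightarrow>
     (\<forall>m\<in>Poly_Mapping.keys p. (\<Sum>v\<in>Poly_Mapping.keys m. Poly_Mapping.lookup m v) \<le> n)"
  by (simp add: total_degree_def)

lemma sum_lookup_add:
  fixes m m' :: "'v \<Rightarrow>\<^sub>0 nat"
  shows "(\<Sum>v\<in>Poly_Mapping.keys (m + m'). Poly_Mapping.lookup (m + m') v) =
    (\<Sum>v\<in>Poly_Mapping.keys m. Poly_Mapping.lookup m v) +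
    (\<Sum>v\<in>Poly_Mapping.keys m'. Poly_Mapping.lookup m' v)"
proof -
  \<comment> \<open>Exponents vanish outside the keys of a monomial, so all three sums may run over
    this common set.\<close>
  let ?A = "Poly_Mapping.keys m \<union> Poly_Mapping.keys m'"
  have "(\<Sum>v\<in>Poly_Mapping.keys k. Poly_Mapping.lookup k v) = (\<Sum>v\<in>?A. Poly_Mapping.lookup k v)"
    if "Poly_Mapping.keys k \<subseteq> ?A" for k :: "'v \<Rightarrow>\<^sub>0 nat"
    using that by (intro sum.mono_neutral_left) (auto simp: in_keys_iff)
  from this[of m] this[of m'] this[OF Poly_Mapping.keys_add] show ?thesis
    by (simp add: lookup_add sum.distrib)
qed

lemma total_degree_add_le:
  "total_degree p \<le> n \<Longrightarrow> total_degree q \<le> n \<Longrightarrow> total_degree (p + q) \<le> n"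
  using Poly_Mapping.keys_add[of p q] unfolding total_degree_le_iff by blast

lemma total_degree_uminus [simp]: "total_degree (- p) = total_degree p"
  by (simp add: total_degree_def)

lemma total_degree_mult_le: "total_degree (p * q) \<le> total_degree p + total_degree q"
  unfolding total_degree_le_iff
proof
  fix m assume "m \<in> Poly_Mapping.keys (p * q)"
  then obtain a b where "m = a + b" "a \<in> Poly_Mapping.keys p" "b \<in> Poly_Mapping.keys q"
    using keys_mult[of p q] by blast
  then show "(\<Sum>v\<in>Poly_Mapping.keys m. Poly_Mapping.lookup m v) \<le> total_degree p + total_degree q"
    using total_degree_le_iff[of p "total_degree p"] total_degree_le_iff[of q "total_degree q"]
    by (auto simp: sum_lookup_add intro!: add_mono)
qed

lemma total_degree_Const\<^sub>p [simp]: "total_degree (Const\<^sub>p c) = 0"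
  by (simp add: total_degree_def Const\<^sub>p_def)

lemma total_degree_one [simp]: "total_degree 1 = 0"
  by (simp add: total_degree_def)

lemma total_degree_xv [simp]: "total_degree (xv g h) = 1"
  by (simp add: total_degree_def xv_def Var\<^sub>p_def)

lemma total_degree_Const\<^sub>p_mult_le:
  "total_degree p \<le> n \<Longrightarrow> total_degree (Const\<^sub>p c * p) \<le> n"
  using total_degree_mult_le[of "Const\<^sub>p c" p] by simp

lemma total_degree_sum_le:
  "(\<And>i. i \<in> A \<Longrightarrow> total_degree (f i) \<le> n) \<Longrightarrow> total_degree (sum f A) \<le> n"
  by (induction A rule: infinite_finite_induct)
    (auto intro: total_degree_add_le simp: total_degree_le_iff[of 0])

text \<open>An infinite index set is covered by convention: its product is 1 and its cardinality
  0.\<close>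

lemma total_degree_prod_le:
  "(\<And>i. i \<in> A \<Longrightarrow> total_degree (f i) \<le> 1) \<Longrightarrow> total_degree (prod f A) \<le> card A"
proof (induction A rule: infinite_finite_induct)
  case (insert x F)
  have "total_degree (f x * prod f F) \<le> total_degree (f x) + total_degree (prod f F)"
    by (rule total_degree_mult_le)
  also have "\<dots> \<le> 1 + card F"
    using insert by (intro add_mono) auto
  finally show ?case using insert by simp
qed simp_all

section \<open>Elementary symmetric polynomials of a cross\<close>

lemma total_degree_rho_le: "total_degree (rho VG VH g h i) \<le> i"
  unfolding rho_def
  by (intro total_degree_sum_le order.trans[OF total_degree_prod_le]) (auto simp: case_prod_unfold)

text \<open>The elementary symmetric polynomial over an arbitrary index set. Unlike
  \<open>rho\<close>, which is tied to crosses, it admits a recursion on the set.\<close>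

definition esym :: "('b \<Rightarrow> 'a::comm_semiring_1) \<Rightarrow> 'b set \<Rightarrow> nat \<Rightarrow> 'a" where
  "esym f T i = (\<Sum>S | S \<subseteq> T \<and> card S = i. \<Prod>x\<in>S. f x)"

lemma esym_0: "finite T \<Longrightarrow> esym f T 0 = 1"
proof -
  assume "finite T"
  \<comment> \<open>Finiteness of \<open>T\<close> rules out infinite \<open>S\<close>, whose
    \<open>card\<close> would also be 0.\<close>
  then have "{S. S \<subseteq> T \<and> card S = 0} = {{}}"
    by (auto dest: finite_subset)
  then show ?thesis by (simp add: esym_def)
qed

lemma esym_empty_Suc: "esym f {} (Suc i) = 0"
proof -
  have empty: "{S. S \<subseteq> {} \<and> card S = Suc i} = {}" by auto
  show ?thesis unfolding esym_def empty by simp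
qed

text \<open>Pascal's rule: the subsets are split by whether they contain \<open>a\<close>. Repeated
  rewriting with it expands \<open>rho\<close> on an explicit cross.\<close>

lemma esym_insert_Suc:
  assumes "finite T" "a \<notin> T"
  shows "esym f (insert a T) (Suc i) = esym f T (Suc i) + f a * esym f T i"
proof -
  let ?A = "{S. S \<subseteq> T \<and> card S = Suc i}" and ?B = "{S. S \<subseteq> T \<and> card S = i}"
  have fin: "finite S" "a \<notin> S" if "S \<subseteq> T" for S
    using that assms by (auto dest: finite_subset)
  have split: "{S. S \<subseteq> insert a T \<and> card S = Suc i} = ?A \<union> insert a ` ?B"
  proof (intro equalityI subsetI)
    fix S assume S: "S \<in> {S. S \<subseteq> insert a T \<and> card S = Suc i}"
    show "S \<in> ?A \<union> insert a ` ?B"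
    proof (cases "a \<in> S")
      case True
      then have "S = insert a (S - {a})" "S - {a} \<in> ?B"
        using S by auto
      then show ?thesis by blast
    qed (use S in auto)
  qed (use fin in auto)
  have inj: "inj_on (insert a) ?B"
    using fin by (intro inj_onI) (metis (mono_tags) insert_ident mem_Collect_eq)
  have "esym f (insert a T) (Suc i) = (\<Sum>S\<in>?A. prod f S) + (\<Sum>S\<in>insert a ` ?B. prod f S)"
    unfolding esym_def split using assms by (intro sum.union_disjoint) auto
  also have "(\<Sum>S\<in>insert a ` ?B. prod f S) = (\<Sum>S\<in>?B. f a * prod f S)"
    unfolding sum.reindex[OF inj] comp_def using fin by (intro sum.cong) auto
  finally show ?thesis
    by (simp add: esym_def sum_distrib_left)
qed

lemma rho_eq_esym: "rho VG VH g h i = esym (\<lambda>(g', h'). xv g' h') (cross_set VG VH g h) i"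
  by (simp add: rho_def esym_def)

section \<open>The certificate\<close>

text \<open>The coefficients enter only through three relations, shared by all four triples, so a
  single proof serves them all.\<close>

lemma viz_certificate_cross:
  fixes g1 g :: 'g and h1 h :: 'h
  assumes K: "subfield K real_ring" "\<alpha> \<in> K" "\<beta> \<in> K" "\<delta> \<in> K"
    and VG: "card VG = 3" "g1 \<in> VG"
    and VH: "card VH = 2" "h1 \<in> VH"
    and coeffs: "\<alpha>\<^sup>2 = 3" "\<alpha> * \<beta> = - 4 / 3" "\<beta>\<^sup>2 + \<delta>\<^sup>2 = 2 / 3"
    and gh: "g \<in> VG" "h \<in> VH"
  shows "sos_certificate (viz_ring K VG VH) (viz_ideal K VG g1 VH h1) 2 (viz_poly VG VH 1 1)
    (image_mset (\<lambda>(g', h'). xv g' h') (mset_set ((VG - {g}) \<times> (VH - {h})))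
     + {# - Const\<^sub>p \<alpha> + Const\<^sub>p \<alpha> * rho VG VH g h 1 + Const\<^sub>p \<beta> * rho VG VH g h 2,
          Const\<^sub>p \<delta> * rho VG VH g h 2 #})"
    (is "sos_certificate _ ?I _ _ (image_mset ?x (mset_set ?O) + {# ?s\<^sub>1, ?s\<^sub>2 #})")
proof -
  let ?C = "carrier (viz_ring K VG VH)"
  interpret subring_ideal ?C ?I
    unfolding viz_ideal_def viz_ring_def
    by (rule subring_ideal_genideal[OF K(1)])
      (use viz_generators_carrier[OF K(1) VG(2) VH(2)] in \<open>simp add: viz_ring_def\<close>)
  note gen = generator_in_viz_ideal[OF K(1) VG(2) VH(2)]
  have finV: "finite VG" "finite VH"
    using VG VH by (auto intro: card_ge_0_finite)
  have xC: "xv g' h' \<in> ?C" if "g' \<in> VG" "h' \<in> VH" for g' h'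
    using xv_carrier[OF K(1) that] .
  have constC: "Const\<^sub>p c \<in> ?C" if "c \<in> K" for c
    using Const\<^sub>p_carrier[OF that] by (simp add: viz_ring_def)
  have idem: "xv g' h' * (xv g' h' - 1) \<in> ?I" if "g' \<in> VG" "h' \<in> VH" for g' h'
    using that by (intro gen) (auto simp: viz_generators_def)

  have "card (VG - {g}) = 2" using VG gh finV by simp
  then obtain g2 g3 where g23: "VG - {g} = {g2, g3}" "g2 \<noteq> g3"
    by (auto simp: card_2_iff)
  have "card (VH - {h}) = 1" using VH gh finV by simp
  then obtain h2 where h2: "VH - {h} = {h2}"
    by (auto simp: card_1_singleton_iff)
  have mem: "g2 \<in> VG" "g3 \<in> VG" "h2 \<in> VH" "g2 \<noteq> g" "g3 \<noteq> g" "h2 \<noteq> h"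
    using g23 h2 by auto
  have VG_eq: "VG = {g, g2, g3}" and VH_eq: "VH = {h, h2}"
    using g23 h2 gh by auto
  \<comment> \<open>A cross in a 3 by 2 grid has 3 + 2 - 1 = 4 cells, one for each idempotent of
    \<open>four_idempotents_sos\<close>.\<close>
  have cross: "cross_set VG VH g h = {(g, h), (g2, h), (g3, h), (g, h2)}"
    using mem unfolding cross_set_def VG_eq VH_eq by auto
  define a b c d where abcd: "a = xv g h" "b = xv g2 h" "c = xv g3 h" "d = xv g h2"
  have abcdC: "a \<in> ?C" "b \<in> ?C" "c \<in> ?C" "d \<in> ?C"
    unfolding abcd using xC gh mem by auto
  have abcd_idem: "a * (a - 1) \<in> ?I" "b * (b - 1) \<in> ?I" "c * (c - 1) \<in> ?I" "d * (d - 1) \<in> ?I"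
    unfolding abcd using idem gh mem by auto
  have rho1: "rho VG VH g h 1 = a + b + c + d"
    using mem g23 gh
    by (simp add: rho_eq_esym cross esym_insert_Suc esym_empty_Suc esym_0 abcd)
  have rho2: "rho VG VH g h 2 = a * b + a * c + a * d + b * c + b * d + c * d"
    using mem g23 gh
    by (simp add: rho_eq_esym cross esym_insert_Suc esym_empty_Suc esym_0 numeral_2_eq_2 abcd
        algebra_simps)

  have eC: "eG g g' \<in> ?C" if "g' \<in> VG" "g' \<noteq> g" for g'
    using that gh subfield_real_closed[OF K(1)]
    by (auto simp: eG_def Var\<^sub>p_def viz_ring_def viz_vars_def mpoly_ring_def)
  have eC': "eH h h2 \<in> ?C"
    using mem gh subfield_real_closed[OF K(1)]
    by (auto simp: eH_def Var\<^sub>p_def viz_ring_def viz_vars_def mpoly_ring_def)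
  have "(1 - xv g h) * (\<Prod>g'\<in>VG - {g}. 1 - eG g g' * xv g' h)
      * (\<Prod>h'\<in>VH - {h}. 1 - eH h h' * xv g h') \<in> ?I"
    by (rule gen) (use gh in \<open>unfold viz_generators_def, blast\<close>)
  then have "((1 - a) * (1 - eG g g2 * b) * (1 - eG g g3 * c)) * (1 - eH h h2 * d) \<in> ?I"
    using g23 h2 by (simp add: abcd mult.assoc)
  \<comment> \<open>\<open>absorb_idempotent\<close> acts on the last factor, so each remaining edge
    factor is moved to the end in turn. \<open>rotated 4\<close> puts the premise met by the chained
    fact first.\<close>
  then have "((1 - a) * (1 - eG g g2 * b) * (1 - eG g g3 * c)) * (1 - d) \<in> ?I"
    by (rule absorb_idempotent[rotated 4]) (intro carrier_intros abcdC abcd_idem eC eC' mem)+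
  then have "((1 - a) * (1 - eG g g2 * b) * (1 - d)) * (1 - eG g g3 * c) \<in> ?I"
    by (simp add: ac_simps)
  then have "((1 - a) * (1 - eG g g2 * b) * (1 - d)) * (1 - c) \<in> ?I"
    by (rule absorb_idempotent[rotated 4]) (intro carrier_intros abcdC abcd_idem eC eC' mem)+
  then have "((1 - a) * (1 - c) * (1 - d)) * (1 - eG g g2 * b) \<in> ?I"
    by (simp add: ac_simps)
  then have "((1 - a) * (1 - c) * (1 - d)) * (1 - b) \<in> ?I"
    by (rule absorb_idempotent[rotated 4]) (intro carrier_intros abcdC abcd_idem eC eC' mem)+
  then have cover: "(1 - a) * (1 - b) * (1 - c) * (1 - d) \<in> ?I"
    by (simp add: ac_simps)

  note const_rules = Const\<^sub>p_numeral Const\<^sub>p_mult Const\<^sub>p_add Const\<^sub>p_uminus power2_eq_square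
  have on_cross: "rho VG VH g h 1 - 1 - (?s\<^sub>1\<^sup>2 + ?s\<^sub>2\<^sup>2) \<in> ?I"
    unfolding rho1 rho2
  proof (rule four_idempotents_sos[OF abcdC constC constC constC abcd_idem cover])
    show "(Const\<^sub>p \<alpha> :: ('g, 'h) viz_var real_mpoly)\<^sup>2 = 3"
      using coeffs(1) unfolding const_rules by simp
    \<comment> \<open>Fractions stay inside \<open>Const\<^sub>p\<close>, where real arithmetic
      applies: 2(-4/3) + 2/3 = -2, 6(-4/3) = -8 and 6(2/3) = 4.\<close>
    have ab: "Const\<^sub>p \<alpha> * Const\<^sub>p \<beta> = (Const\<^sub>p (- 4 / 3) :: ('g, 'h) viz_var real_mpoly)"
      unfolding const_rules coeffs(2) ..
    have bd: "(Const\<^sub>p \<beta>)\<^sup>2 + (Const\<^sub>p \<delta>)\<^sup>2 = (Const\<^sub>p (2 / 3) :: ('g, 'h) viz_var real_mpoly)"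
      using coeffs(3) unfolding const_rules by (simp only:)
    show "2 * (Const\<^sub>p \<alpha> * Const\<^sub>p \<beta>) + ((Const\<^sub>p \<beta>)\<^sup>2 + (Const\<^sub>p \<delta>)\<^sup>2)
        = (- 2 :: ('g, 'h) viz_var real_mpoly)"
      "6 * (Const\<^sub>p \<alpha> * Const\<^sub>p \<beta>) = (- 8 :: ('g, 'h) viz_var real_mpoly)"
      "6 * ((Const\<^sub>p \<beta>)\<^sup>2 + (Const\<^sub>p \<delta>)\<^sup>2) = (4 :: ('g, 'h) viz_var real_mpoly)"
      unfolding ab bd unfolding const_rules by simp_all
  qed (use K in auto)

  \<comment> \<open>The whole constant -1 is assigned to the cross, leaving outside it a plain sum
    of variables.\<close>
  have viz_poly_split: "viz_poly VG VH 1 1 = rho VG VH g h 1 - 1 + (\<Sum>v\<in>?O. ?x v)"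
  proof -
    have "VG \<times> VH = {(g, h), (g2, h), (g3, h), (g, h2)} \<union> ?O"
      using mem unfolding VG_eq VH_eq by auto
    moreover have "(\<Sum>v\<in>{(g, h), (g2, h), (g3, h), (g, h2)} \<union> ?O. ?x v) =
        (\<Sum>v\<in>{(g, h), (g2, h), (g3, h), (g, h2)}. ?x v) + (\<Sum>v\<in>?O. ?x v)"
      using finV by (intro sum.union_disjoint) auto
    ultimately show ?thesis
      unfolding rho1 using mem g23 by (simp add: viz_poly_def abcd)
  qed
  have "viz_poly VG VH 1 1 - (\<Sum>s\<in>#image_mset ?x (mset_set ?O) + {# ?s\<^sub>1, ?s\<^sub>2 #}. s\<^sup>2)
      = viz_poly VG VH 1 1 - ((\<Sum>v\<in>?O. (?x v)\<^sup>2) + (?s\<^sub>1\<^sup>2 + ?s\<^sub>2\<^sup>2))"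
    by (simp add: image_mset.compositionality comp_def sum_unfold_sum_mset)
  \<comment> \<open>Outside the cross, x - x^2 = -x(x - 1) is a negated idempotency
    generator.\<close>
  also have "\<dots> = (rho VG VH g h 1 - 1 - (?s\<^sub>1\<^sup>2 + ?s\<^sub>2\<^sup>2)) - (\<Sum>v\<in>?O. ?x v * (?x v - 1))"
    unfolding viz_poly_split by (simp add: algebra_simps sum_subtractf power2_eq_square)
  also have "\<dots> \<in> ?I"
    using idem by (intro ideal_diff on_cross ideal_sum) auto
  finally have "viz_poly VG VH 1 1
      - (\<Sum>s\<in>#image_mset ?x (mset_set ?O) + {# ?s\<^sub>1, ?s\<^sub>2 #}. s\<^sup>2) \<in> ?I" .
  moreover have "s \<in> ?C \<and> total_degree s \<le> 2"
    if s: "s \<in># image_mset ?x (mset_set ?O) + {# ?s\<^sub>1, ?s\<^sub>2 #}" for s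
  proof -
    have deg: "total_degree (rho VG VH g h 1) \<le> 2" "total_degree (rho VG VH g h 2) \<le> 2"
      using total_degree_rho_le[of VG VH g h 1] total_degree_rho_le[of VG VH g h 2] by auto
    have rhoC: "rho VG VH g h i \<in> ?C" for i
      unfolding rho_def using xC by (intro sum prod) (auto simp: cross_set_def)
    have "?s\<^sub>1 \<in> ?C" "?s\<^sub>2 \<in> ?C"
      by (intro carrier_intros constC rhoC K)+
    moreover have "total_degree ?s\<^sub>1 \<le> 2" "total_degree ?s\<^sub>2 \<le> 2"
      by (intro total_degree_add_le total_degree_Const\<^sub>p_mult_le deg; simp)+
    ultimately show ?thesis
      using s finV xC by auto
  qed
  ultimately show ?thesis
    unfolding sos_certificate_def by blast
qed

section \<open>Domination numbers\<close>

text \<open>The empty set cannot dominate a vertex. The vertex set dominates itself and has finitely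
  many subsets, so \<open>Min\<close> is taken over a finite nonempty set.\<close>

lemma domination_number_pos:
  assumes "finite (pverts G)" "pverts G \<noteq> {}"
  shows "domination_number G \<ge> 1"
proof -
  have "{D. dominating_set G D} \<subseteq> Pow (pverts G)"
    by (auto simp: dominating_set_def)
  then have fin: "finite {D. dominating_set G D}"
    using assms finite_subset by blast
  have "dominating_set G (pverts G)"
    by (simp add: dominating_set_def)
  then have ne: "{D. dominating_set G D} \<noteq> {}"
    by blast
  have "card D \<ge> 1" if "dominating_set G D" for D
  proof -
    have "finite D" "D \<noteq> {}"
      using that assms by (auto simp: dominating_set_def dest: finite_subset)
    then show ?thesis
      by (simp add: Suc_le_eq card_gt_0_iff)
  qed
  then show ?thesis
    unfolding domination_number_def using fin ne by simp
qed

theorem theorem4p1: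
  fixes K :: "real set"
    and VG :: "'g set" and VH :: "'h set"
    and g1 :: 'g and h1 :: 'h
    and \<alpha> \<beta> \<delta> :: real
  assumes K: "subfield K real_ring" "\<alpha> \<in> K" "\<beta> \<in> K" "\<delta> \<in> K"
    and VG: "card VG = 3" "g1 \<in> VG"
    and VH: "card VH = 2" "h1 \<in> VH"
    and coeffs: "(\<alpha>, \<beta>, \<delta>) \<in>
      {(- sqrt 3,   4/9 * sqrt 3, - (1/9) * sqrt 6),
       (- sqrt 3,   4/9 * sqrt 3,    1/9 * sqrt 6),
       (  sqrt 3, - (4/9) * sqrt 3, - (1/9) * sqrt 6),
       (  sqrt 3, - (4/9) * sqrt 3,    1/9 * sqrt 6)}"
  shows "(\<forall>g\<in>VG. \<forall>h\<in>VH.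
            sos_certificate (viz_ring K VG VH) (viz_ideal K VG g1 VH h1) 2 (viz_poly VG VH 1 1)
              (image_mset (\<lambda>(g', h'). xv g' h') (mset_set ((VG - {g}) \<times> (VH - {h})))
               + {# - Const\<^sub>p \<alpha> + Const\<^sub>p \<alpha> * rho VG VH g h 1 + Const\<^sub>p \<beta> * rho VG VH g h 2,
                    Const\<^sub>p \<delta> * rho VG VH g h 2 #}))
       \<and> (\<forall>G\<in>graph_class VG {g1}. \<forall>H\<in>graph_class VH {h1}.
            domination_number (G \<box> H) \<ge> domination_number G * domination_number H)"
proof (intro conjI ballI)
  \<comment> \<open>The triples differ only in the signs of \<alpha> and \<delta>, and \<beta>
    follows \<alpha>.\<close>
  have \<alpha>: "\<alpha>\<^sup>2 = 3" and \<delta>: "\<delta>\<^sup>2 = 2 / 27" and \<beta>: "\<beta> = - (4 / 9) * \<alpha>"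
    using coeffs unfolding insert_iff prod.inject empty_iff
    by (elim disjE conjE FalseE; hypsubst; simp add: power2_eq_square)+
  have *: "\<alpha>\<^sup>2 = 3" "\<alpha> * \<beta> = - 4 / 3" "\<beta>\<^sup>2 + \<delta>\<^sup>2 = 2 / 3"
    using \<alpha> \<delta> by (simp_all add: \<beta> power2_eq_square)
  fix g h assume "g \<in> VG" "h \<in> VH"
  then show "sos_certificate (viz_ring K VG VH) (viz_ideal K VG g1 VH h1) 2 (viz_poly VG VH 1 1)
      (image_mset (\<lambda>(g', h'). xv g' h') (mset_set ((VG - {g}) \<times> (VH - {h})))
       + {# - Const\<^sub>p \<alpha> + Const\<^sub>p \<alpha> * rho VG VH g h 1 + Const\<^sub>p \<beta> * rho VG VH g h 2,
            Const\<^sub>p \<delta> * rho VG VH g h 2 #})"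
    by (intro viz_certificate_cross K VG VH *)
next
  fix G H assume G: "G \<in> graph_class VG {g1}" and H: "H \<in> graph_class VH {h1}"
  \<comment> \<open>The inequality is obtained on the graphs themselves: with one-element minimum
    dominating sets the right side is 1, and the product graph is nonempty.\<close>
  have "domination_number G = 1" "domination_number H = 1"
    using G H by (auto simp: graph_class_def min_dominating_set_def)
  moreover have "domination_number (G \<box> H) \<ge> 1"
  proof (rule domination_number_pos)
    have "pverts (G \<box> H) = VG \<times> VH"
      using G H by (simp add: graph_class_def cart_prod_def)
    then show "finite (pverts (G \<box> H))" "pverts (G \<box> H) \<noteq> {}"
      using VG VH by (auto intro!: finite_cartesian_product intro: card_ge_0_finite)
  qed
  ultimately show "domination_number (G \<box> H) \<ge> domination_number G * domination_number H"
    by simp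
qed

end
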